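(* Let $n\geq 3$ be an integer, let $(x,y)\in\mathcal{B}^{\flat}_{n}$ be a point and let $z\in\mathbb{R}$ be a real number. \begin{itemize} \item[(a)] The boundary of $\mathcal{A}_{3,n}$ is the union of $\mathcal{B}^{+}_{n}$ and $\mathcal{B}^{-}_{n}$. \item[(b)] We have $\pi(\mathcal{B}^{+}_{n})=\pi(\mathcal{B}^{-}_{n})=\mathcal{B}^{\flat}_{n}$. \item[(c)] There exist unique numbers $z^{+},z^{-}\in\mathbb{R}$ such that $(x,y,z^{+})\in\mathcal{B}^{+}_{n}$ and $(x,y,z^{-})\in\mathcal{B}^{-}_{n}$. We have $z^{+}\geq z^{-}$. Moreover, equality holds precisely when the point $(x,y)$ lies on the boundary of $\mathcal{B}^{\flat}_{n}$. \item[(d)] With $z^{+},z^{-}$ the numbers from (c), we have $(x,y,z)\in\mathcal{A}_{3,n}$ if and only if $z^{+}\geq z\geq z^{-}$. \item[(e)] Every point $p$ on the boundary of $\mathcal{A}_{3,n}$ can be written as $p=\sum_{i=1}^n (t_i,t_i^2,t_i^3)$ for some tuple $(t_1,\dots,t_n)\in[-1,1]^n$. The set $\{t_1,\dots,t_n\}\setminus\{-1,1\}$ has at most two elements and the tuple $(t_1,\dots,t_n)$ is unique up to permutation of its entries. \end{itemize}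
   Context: $\mathcal{A}_{3,n}=\{\sum_{i=1}^n(t_i,t_i^2,t_i^3)\mid t_1,\dots,t_n\in[-1,1]\}\subseteq\mathbb{R}^3$ is the Minkowski sum of $n$ copies of the twisted cubic segment $\{(t,t^2,t^3)\mid -1\leq t\leq 1\}$. For integers $k,\ell\geq1$ and $a,b\geq0$, \begin{align*} \mathcal{C}^{+}_{k,a}&=\left\{k(s,s^2,s^3)+(t,t^2,t^3)+a(1,1,1)\,\middle|\,-1\leq s\leq t\leq 1\right\},\\ \mathcal{C}^{-}_{\ell,b}&=\left\{(s,s^2,s^3)+\ell(t,t^2,t^3)+b(-1,1,-1)\,\middle|\,-1\leq s\leq t\leq 1\right\}. \end{align*} $\mathcal{B}^{+}_{n}=\bigcup_{k=1}^{n-1}\mathcal{C}^{+}_{k,n-k-1}$ and $\mathcal{B}^{-}_{n}=\bigcup_{\ell=1}^{n-1}\mathcal{C}^{-}_{\ell,n-\ell-1}$. $\mathcal{B}^{\flat}_{n}$ is the set of all points $(x,y)\in\mathbb{R}^2$ such that $ny\geq x^2$ and $y\leq n-1+(x+2i-(n-1))^2$ for each $i\in\{0,\dots,n-1\}$. $\pi\colon\mathbb{R}^3\to\mathbb{R}^2$ is the projection $(x,y,z)\mapsto(x,y)$.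
   Formalization: The condition |x| ≤ n is added to the definition of B♭_n; without it (b) and (c) fail, e.g. for n = 3 the point (4, 11/2) satisfies the stated inequalities but does not lie in the projection of A_{3,3}. *)

theory Defs
  imports "HOL-Analysis.Analysis" "HOL-Combinatorics.Permutations"
begin

definition twisted_cubic :: "real \<Rightarrow> real \<times> real \<times> real" where
  "twisted_cubic t = (t, t^2, t^3)"

definition A3 :: "nat \<Rightarrow> (real \<times> real \<times> real) set" where
  "A3 n = {\<Sum>i=1..n. twisted_cubic (t i) | t. t \<in> {1..n} \<rightarrow> {-1..1}}"

definition C_plus :: "nat \<Rightarrow> nat \<Rightarrow> (real \<times> real \<times> real) set" where
  "C_plus k a =
     {real k *\<^sub>R twisted_cubic s + twisted_cubic t + real a *\<^sub>R (1, 1, 1) | s t.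
        -1 \<le> s \<and> s \<le> t \<and> t \<le> 1}"

definition C_minus :: "nat \<Rightarrow> nat \<Rightarrow> (real \<times> real \<times> real) set" where
  "C_minus l b =
     {twisted_cubic s + real l *\<^sub>R twisted_cubic t + real b *\<^sub>R (-1, 1, -1) | s t.
        -1 \<le> s \<and> s \<le> t \<and> t \<le> 1}"

definition B_plus :: "nat \<Rightarrow> (real \<times> real \<times> real) set" where
  "B_plus n = (\<Union>k\<in>{1..n-1}. C_plus k (n - k - 1))"

definition B_minus :: "nat \<Rightarrow> (real \<times> real \<times> real) set" where
  "B_minus n = (\<Union>l\<in>{1..n-1}. C_minus l (n - l - 1))"

(* The bound |x| <= n is implicit in the source, which lists only the other two conditions.
   Without it the set has two spurious unbounded components in |x| > n that do not
   meet the projection of A3 n: for n = 3 the point (4, 11/2) satisfies 3 y >= x^2 and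
   y <= 2 + (x + 2 i - 2)^2 for i = 0, 1, 2, although every point of A3 3 has |x| <= 3. *)
definition B_flat :: "nat \<Rightarrow> (real \<times> real) set" where
  "B_flat n =
     {(x, y). \<bar>x\<bar> \<le> real n \<and> real n * y \<ge> x^2 \<and>
        (\<forall>i\<in>{0..n-1}. y \<le> (real n - 1) + (x + 2 * real i - (real n - 1))^2)}"

definition proj_xy :: "real \<times> real \<times> real \<Rightarrow> real \<times> real" where
  "proj_xy = (\<lambda>(x, y, z). (x, y))"

end

theory Submission
  imports Defs
begin

text \<open>
  Consider the tuples in \<open>[-1,1]\<^sup>n\<close> with prescribed \<open>\<Sum>i. t i\<close> and \<open>\<Sum>i. (t i)\<^sup>2\<close>. Three entries
  \<open>u < v \<le> w < 1\<close> can be moved so that these two sums are kept and \<open>\<Sum>i. (t i)\<^sup>3\<close> increases by an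
  arbitrarily small amount. Hence a tuple maximising the third coordinate has no such triple, that
  is, up to order it is \<open>(s, \<dots>, s, t, 1, \<dots>, 1)\<close> with \<open>s \<le> t\<close>; since the first two power sums
  determine a tuple of this shape, \<open>B_plus n\<close> is exactly the set of the highest points of the fibres
  of \<open>A3 n\<close> over the plane. The symmetry \<open>t \<mapsto> -t\<close> gives the lowest points. The fibres have no
  gaps because the point below a gap could be raised slightly. Finally, highest and lowest points
  coincide exactly over the boundary of \<open>B_flat n\<close>, where all entries are equal or at most one entry
  lies in \<open>(-1, 1)\<close>.
\<close>

section \<open>Moving three entries with fixed power sums\<close>

text \<open>Move \<open>u\<close> to \<open>u + h\<close>; the two power sums then determine \<open>v'\<close> and \<open>w'\<close> as the roots of a quadratic
  with discriminant \<open>D h\<close>. As \<open>u + h\<close> becomes a root of the cubic with roots \<open>u, v, w\<close> once its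
  constant term is lowered by \<open>h (h + u - v) (h + u - w)\<close>, the sum of cubes changes by \<open>\<delta> h\<close>.\<close>

lemma three_point_move:
  fixes u v w \<epsilon> :: real
  assumes "-1 \<le> u" "u < v" "v \<le> w" "w < 1" "\<epsilon> > 0"
  obtains u' v' w' where "u' \<in> {-1..1}" "v' \<in> {-1..1}" "w' \<in> {-1..1}"
    "u' + v' + w' = u + v + w" "u'^2 + v'^2 + w'^2 = u^2 + v^2 + w^2"
    "u^3 + v^3 + w^3 < u'^3 + v'^3 + w'^3" "u'^3 + v'^3 + w'^3 < u^3 + v^3 + w^3 + \<epsilon>"
proof -
  define D where "D h = (w - v)^2 + h * (2 * (v + w - 2 * u) - 3 * h)" for h
  define v' where "v' h = (v + w - h - sqrt (D h)) / 2" for h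
  define w' where "w' h = (v + w - h + sqrt (D h)) / 2" for h
  define \<delta> where "\<delta> h = 3 * (h * ((v - u - h) * (w - u - h)))" for h
  have D0: "sqrt (D 0) = w - v"
    using assms by (simp add: D_def)
  have "continuous (at 0 within {0<..}) D" unfolding D_def by (intro continuous_intros)
  hence D: "(D \<longlongrightarrow> D 0) (at_right 0)" by (simp add: continuous_within)
  have v': "(v' \<longlongrightarrow> v) (at_right 0)"
    unfolding v'_def by (rule tendsto_eq_intros D refl | simp add: D0)+
  have w': "(w' \<longlongrightarrow> w) (at_right 0)"
    unfolding w'_def by (rule tendsto_eq_intros D refl | simp add: D0)+
  have \<delta>: "(\<delta> \<longlongrightarrow> 0) (at_right 0)"
    unfolding \<delta>_def by (rule tendsto_eq_intros refl | simp)+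
  have lin: "((\<lambda>h. 2 * (v + w - 2 * u) - 3 * h) \<longlongrightarrow> 2 * (v + w - 2 * u)) (at_right 0)"
    by (rule tendsto_eq_intros refl | simp)+
  have idt: "((\<lambda>h::real. h) \<longlongrightarrow> 0) (at_right 0)" by simp
  \<comment> \<open>Apart from \<open>h > 0\<close>, each conjunct is a strict inequality that holds
    in the limit \<open>h = 0\<close>. The last one keeps \<open>D h\<close> nonnegative even if
    \<open>v = w\<close>, where \<open>D 0 = 0\<close>.\<close>
  have "eventually (\<lambda>h. h > 0 \<and> h < v - u \<and> h < 1 - u \<and> v' h > -1 \<and> w' h < 1 \<and> \<delta> h < \<epsilon> \<and>
          2 * (v + w - 2 * u) - 3 * h > 0) (at_right 0)"
    using order_tendstoD(2)[OF idt, of "v - u"] order_tendstoD(2)[OF idt, of "1 - u"]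
      order_tendstoD(1)[OF v', of "-1"]
      order_tendstoD(2)[OF w', of 1] order_tendstoD(2)[OF \<delta>, of \<epsilon>]
      order_tendstoD(1)[OF lin, of 0] assms eventually_at_right_less[of "0::real"]
    by (intro eventually_conj) auto
  then obtain h where h: "h > 0" "h < v - u" "h < 1 - u" "v' h > -1" "w' h < 1" "\<delta> h < \<epsilon>"
      "2 * (v + w - 2 * u) - 3 * h > 0"
    using eventually_happens[of _ "at_right (0::real)"] trivial_limit_at_right_real by blast
  have Dh: "D h \<ge> 0" using h by (simp add: D_def)
  hence vw: "v' h \<le> w' h" by (simp add: v'_def w'_def)
  have sum: "v' h + w' h = v + w - h" by (simp add: v'_def w'_def field_simps)
  have "v' h ^ 2 + w' h ^ 2 = ((v + w - h)^2 + sqrt (D h)^2) / 2"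
    unfolding v'_def w'_def by (simp add: power2_eq_square field_simps)
  also have "\<dots> = v^2 + w^2 + u^2 - (u + h)^2"
    unfolding real_sqrt_pow2[OF Dh] unfolding D_def by (simp add: power2_eq_square field_simps)
  finally have sq: "v' h ^ 2 + w' h ^ 2 = v^2 + w^2 + u^2 - (u + h)^2" .
  \<comment> \<open>The sum and the sum of squares of two numbers determine their sum of cubes, so
    the square roots never have to be cubed.\<close>
  have cube: "a^3 + b^3 = (a + b) * (3 * (a^2 + b^2) - (a + b)^2) / 2" for a b :: real
    by (simp add: power2_eq_square power3_eq_cube field_simps)
  have "v' h ^ 3 + w' h ^ 3 = (v + w - h) * (3 * (v^2 + w^2 + u^2 - (u + h)^2) - (v + w - h)^2) / 2"
    by (simp only: cube sum sq)
  hence cubes: "(u + h)^3 + v' h ^ 3 + w' h ^ 3 = u^3 + v^3 + w^3 + \<delta> h"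
    by (simp add: \<delta>_def power2_eq_square power3_eq_cube field_simps)
  have "\<delta> h > 0" using h assms by (simp add: \<delta>_def)
  show thesis
    by (rule that[of "u + h" "v' h" "w' h"])
      (use h vw sum sq cubes \<open>\<delta> h > 0\<close> assms in auto)
qed

text \<open>The situation of \<open>three_point_move\<close>. The strict \<open>t i < t j\<close>
  already separates \<open>i\<close> from \<open>j\<close> and \<open>k\<close>, while
  \<open>t j = t k\<close> is allowed at different indices.\<close>

definition raisable :: "nat \<Rightarrow> (nat \<Rightarrow> real) \<Rightarrow> bool" where
  "raisable n t \<longleftrightarrow> (\<exists>i\<in>{1..n}. \<exists>j\<in>{1..n}. \<exists>k\<in>{1..n}. j \<noteq> k \<and> t i < t j \<and> t j \<le> t k \<and> t k < 1)"

lemma sum_twisted_cubic: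
  "(\<Sum>i\<in>S. twisted_cubic (t i)) = (\<Sum>i\<in>S. t i, \<Sum>i\<in>S. t i ^ 2, \<Sum>i\<in>S. t i ^ 3)"
  by (simp add: twisted_cubic_def sum_prod)

lemma A3_iff:
  "(x, y, z) \<in> A3 n \<longleftrightarrow> (\<exists>t. t \<in> {1..n} \<rightarrow> {-1..1} \<and> (\<Sum>i=1..n. t i) = x \<and>
     (\<Sum>i=1..n. t i ^ 2) = y \<and> (\<Sum>i=1..n. t i ^ 3) = z)"
  by (auto simp: A3_def sum_twisted_cubic)

lemma sum_fun_upd:
  fixes f :: "'b \<Rightarrow> 'c::ab_group_add"
  assumes "finite S" "i \<in> S"
  shows "(\<Sum>m\<in>S. f ((t(i := u)) m)) = (\<Sum>m\<in>S. f (t m)) - f (t i) + f u"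
proof -
  have "(\<Sum>m\<in>S - {i}. f ((t(i := u)) m)) = (\<Sum>m\<in>S - {i}. f (t m))"
    by (rule sum.cong) auto
  thus ?thesis using assms by (simp add: sum.remove[of S i])
qed

text \<open>The entries supplied by \<open>three_point_move\<close> change only the sum of cubes.
  Keeping the gain below an arbitrary \<open>\<epsilon>\<close> is what later rules out gaps in the
  fibres.\<close>

lemma raisable_imp_higher:
  assumes t: "t \<in> {1..n} \<rightarrow> {-1..1}" and "raisable n t" and "\<epsilon> > 0"
  shows "\<exists>z. (\<Sum>i=1..n. t i, \<Sum>i=1..n. t i ^ 2, z) \<in> A3 n \<and>
    (\<Sum>i=1..n. t i ^ 3) < z \<and> z < (\<Sum>i=1..n. t i ^ 3) + \<epsilon>"
proof -
  obtain i j k where ijk: "i \<in> {1..n}" "j \<in> {1..n}" "k \<in> {1..n}" "j \<noteq> k"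
      "t i < t j" "t j \<le> t k" "t k < 1"
    using assms(2) unfolding raisable_def by blast
  hence ne: "i \<noteq> j" "i \<noteq> k" by auto
  have "-1 \<le> t i" using t ijk by force
  with ijk assms(3) obtain u v w where uvw: "u \<in> {-1..1}" "v \<in> {-1..1}" "w \<in> {-1..1}"
    "u + v + w = t i + t j + t k" "u^2 + v^2 + w^2 = t i^2 + t j^2 + t k^2"
    "t i^3 + t j^3 + t k^3 < u^3 + v^3 + w^3" "u^3 + v^3 + w^3 < t i^3 + t j^3 + t k^3 + \<epsilon>"
    using three_point_move by metis
  define t' where "t' = t(i := u, j := v, k := w)"
  have t': "t' \<in> {1..n} \<rightarrow> {-1..1}" using t uvw by (auto simp: t'_def Pi_iff)
  have new: "(\<Sum>m=1..n. f (t' m)) =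
      (\<Sum>m=1..n. f (t m)) - (f (t i) + f (t j) + f (t k)) + (f u + f v + f w)"
    for f :: "real \<Rightarrow> real"
    unfolding t'_def using ijk ne
    by (simp only: sum_fun_upd finite_atLeastAtMost) (simp add: algebra_simps)
  have "(\<Sum>m=1..n. t' m) = (\<Sum>m=1..n. t m)"
    using new[of "\<lambda>x. x"] uvw by simp
  moreover have "(\<Sum>m=1..n. t' m ^ 2) = (\<Sum>m=1..n. t m ^ 2)"
    using new[of "\<lambda>x. x ^ 2"] uvw by simp
  moreover have "(\<Sum>m=1..n. t m ^ 3) < (\<Sum>m=1..n. t' m ^ 3)"
    "(\<Sum>m=1..n. t' m ^ 3) < (\<Sum>m=1..n. t m ^ 3) + \<epsilon>"
    using new[of "\<lambda>x. x ^ 3"] uvw by auto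
  ultimately show ?thesis using t' by (auto simp: A3_iff)
qed

section \<open>Clustered tuples\<close>

text \<open>The sorted tuple behind the points of \<open>C_plus k (n - k - 1)\<close>. It is padded
  with 1 forever, so \<open>n\<close> enters only through the range of summation.\<close>

definition cluster :: "nat \<Rightarrow> real \<Rightarrow> real \<Rightarrow> nat \<Rightarrow> real" where
  "cluster k s t i = (if i \<le> k then s else if i = Suc k then t else 1)"

lemma sum_cluster:
  fixes f :: "real \<Rightarrow> 'a::real_vector"
  assumes "k < n"
  shows "(\<Sum>i=1..n. f (cluster k s t i)) = real k *\<^sub>R f s + f t + real (n - k - 1) *\<^sub>R f 1"
proof -
  have "(\<Sum>i=1..n. f (cluster k s t i)) =
      (\<Sum>i=1..k. f (cluster k s t i)) + (\<Sum>i=Suc k..n. f (cluster k s t i))"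
    using sum.ub_add_nat[of 1 k "\<lambda>i. f (cluster k s t i)" "n - k"] assms by simp
  also have "(\<Sum>i=Suc k..n. f (cluster k s t i)) = f t + (\<Sum>i=Suc (Suc k)..n. f (cluster k s t i))"
    using assms by (subst sum.atLeast_Suc_atMost) (auto simp: cluster_def)
  also have "(\<Sum>i=1..k. f (cluster k s t i)) = (\<Sum>i=1..k. f s)"
    by (rule sum.cong) (auto simp: cluster_def)
  also have "(\<Sum>i=Suc (Suc k)..n. f (cluster k s t i)) = (\<Sum>i=Suc (Suc k)..n. f 1)"
    by (rule sum.cong) (auto simp: cluster_def)
  finally show ?thesis by (simp add: sum_constant_scaleR)
qed

text \<open>Sorting keeps the multiset of values, and two functions with the same multiset of values
  on \<open>{1..n}\<close> differ by a permutation.\<close>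

lemma sorting_permutation:
  fixes t :: "nat \<Rightarrow> 'a::linorder"
  obtains a p where "p permutes {1..n}" "\<forall>i\<in>{1..n}. t i = a (p i)"
    "\<And>i j. 1 \<le> i \<Longrightarrow> i \<le> j \<Longrightarrow> j \<le> n \<Longrightarrow> a i \<le> a j"
proof -
  define xs where "xs = sort (map t [1..<Suc n])"
  define a where "a i = xs ! (i - 1)" for i
  have len: "length xs = n" by (simp add: xs_def)
  have "map a [1..<Suc n] = xs"
    by (rule nth_equalityI) (auto simp: a_def len simp del: upt_Suc)
  hence "mset (map a [1..<Suc n]) = mset (map t [1..<Suc n])"
    by (simp add: xs_def)
  moreover have "mset [1..<Suc n] = mset_set {1..n}"
    by (metis atLeastLessThanSuc_atLeastAtMost mset_upt)
  ultimately have "image_mset t (mset_set {1..n}) = image_mset a (mset_set {1..n})"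
    by (metis mset_map)
  then obtain p where "p permutes {1..n}" "\<forall>i\<in>{1..n}. t i = a (p i)"
    by (rule image_mset_eq_implies_permutes[OF finite_atLeastAtMost])
  moreover have "a i \<le> a j" if "1 \<le> i" "i \<le> j" "j \<le> n" for i j
    unfolding a_def by (rule sorted_nth_mono) (use that len in \<open>auto simp: xs_def\<close>)
  ultimately show thesis using that by blast
qed

text \<open>Sort the tuple into \<open>a\<close> and let \<open>m\<close> be the last index with
  \<open>a m < 1\<close>. An index \<open>i\<close> strictly between 1 and \<open>m\<close> with
  \<open>a 1 < a i\<close> would give the forbidden triple \<open>1, i, m\<close>. Hence all entries
  before \<open>m\<close> equal \<open>a 1\<close>, and \<open>a m\<close> is the free
  entry.\<close>

lemma not_raisable_imp_cluster:
  assumes t: "t \<in> {1..n} \<rightarrow> {-1..1}" and "\<not> raisable n t" and n: "n \<ge> 2"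
  obtains k s r p where "k \<in> {1..n-1}" "-1 \<le> s" "s \<le> r" "r \<le> 1" "p permutes {1..n}"
    "\<forall>i\<in>{1..n}. t i = cluster k s r (p i)"
proof -
  obtain a p where p: "p permutes {1..n}" and ta: "\<forall>i\<in>{1..n}. t i = a (p i)"
    and mono: "\<And>i j. 1 \<le> i \<Longrightarrow> i \<le> j \<Longrightarrow> j \<le> n \<Longrightarrow> a i \<le> a j"
    using sorting_permutation[of n t] by metis
  have at: "\<exists>i'\<in>{1..n}. a i = t i'" if "i \<in> {1..n}" for i
    using ta permutes_image[OF p] that by (metis imageE)
  have bnd: "a i \<in> {-1..1}" if "i \<in> {1..n}" for i
    using at[OF that] t by auto
  have nr: "\<not> (a i < a j \<and> a j \<le> a k \<and> a k < 1)"
    if "i \<in> {1..n}" "j \<in> {1..n}" "k \<in> {1..n}" "j < k" for i j k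
  proof
    assume *: "a i < a j \<and> a j \<le> a k \<and> a k < 1"
    let ?q = "inv p"
    have q: "?q m \<in> {1..n} \<and> a m = t (?q m)" if "m \<in> {1..n}" for m
      using ta p that by (metis permutes_inv permutes_in_image permutes_inverses(1))
    have "?q j \<noteq> ?q k" using p \<open>j < k\<close> by (metis less_irrefl permutes_inverses(1))
    hence "raisable n t" unfolding raisable_def
      using q[OF that(1)] q[OF that(2)] q[OF that(3)] *
      by (intro bexI[of _ "?q i"] bexI[of _ "?q j"] bexI[of _ "?q k"]) simp_all
    with assms(2) show False by blast
  qed
  \<comment> \<open>The inserted 0 is the value for the tuple whose entries are all 1.\<close>
  define m where "m = Max (insert 0 {i\<in>{1..n}. a i < 1})"
  have m: "m = 0 \<or> m \<in> {1..n} \<and> a m < 1"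
  proof -
    have "m \<in> insert 0 {i\<in>{1..n}. a i < 1}" unfolding m_def by (rule Max_in) auto
    thus ?thesis by blast
  qed
  have m_ge: "i \<le> m" if "i \<in> {1..n}" "a i < 1" for i
    using that Max_ge[of "insert 0 {i\<in>{1..n}. a i < 1}" i] by (simp add: m_def del: Max_insert)
  \<comment> \<open>If at most one entry is below 1, the block consists of \<open>a 1\<close> alone
    and the free entry \<open>a 2\<close> equals 1 or is the only other entry below 1; the maximum
    keeps \<open>k\<close> at least 1.\<close>
  define k where "k = max 1 (m - 1)"
  have k: "k \<in> {1..n-1}" using m n by (auto simp: k_def)
  have "a i = cluster k (a 1) (a (Suc k)) i" if i: "i \<in> {1..n}" for i
  proof -
    consider "i = 1" | "2 \<le> i" "i \<le> k" | "i = Suc k" | "Suc k < i"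
      using i unfolding atLeastAtMost_iff by atomize_elim arith
    thus ?thesis
    proof cases
      case 2
      hence "m \<in> {1..n}" "a m < 1" "i < m" using m by (auto simp: k_def max_def split: if_splits)
      hence "\<not> a 1 < a i" using nr[of 1 i m] mono[of i m] i by force
      thus ?thesis using mono[of 1 i] i 2 by (auto simp: cluster_def)
    next
      case 4
      hence "\<not> a i < 1" using m_ge[of i] i by (auto simp: k_def)
      thus ?thesis using bnd[OF i] 4 by (auto simp: cluster_def)
    qed (use k in \<open>auto simp: cluster_def\<close>)
  qed
  note a_eq = this
  have "\<forall>i\<in>{1..n}. t i = cluster k (a 1) (a (Suc k)) (p i)"
  proof
    fix i assume i: "i \<in> {1..n}"
    hence "p i \<in> {1..n}" using permutes_in_image[OF p] by blast
    thus "t i = cluster k (a 1) (a (Suc k)) (p i)" using a_eq[of "p i"] ta i by (metis (full_types))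
  qed
  moreover have "-1 \<le> a 1" "a 1 \<le> a (Suc k)" "a (Suc k) \<le> 1"
    using bnd[of 1] bnd[of "Suc k"] mono[of 1 "Suc k"] k n by auto
  ultimately show thesis using that k p by blast
qed

text \<open>Since \<open>a - b\<close> sums to zero, any constant \<open>c\<close> may be subtracted
  in \<open>a^2 - b^2 = (a - b)^2 + 2 * b * (a - b)\<close>. Two nonnegative sums then add up to
  zero.\<close>

lemma sums_eq_imp_eq:
  fixes a b :: "'a \<Rightarrow> real"
  assumes "finite S" and sum: "sum a S = sum b S" and sq: "(\<Sum>i\<in>S. a i ^ 2) = (\<Sum>i\<in>S. b i ^ 2)"
    and c: "\<And>i. i \<in> S \<Longrightarrow> (b i - c) * (a i - b i) \<ge> 0" and "i \<in> S"
  shows "a i = b i"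
proof -
  have "(\<Sum>i\<in>S. (a i - b i)^2) + 2 * (\<Sum>i\<in>S. (b i - c) * (a i - b i)) =
     (\<Sum>i\<in>S. a i ^ 2 - b i ^ 2 - 2 * c * (a i - b i))"
    unfolding sum_distrib_left sum.distrib[symmetric]
    by (rule sum.cong) (auto simp: power2_eq_square algebra_simps)
  also have "\<dots> = 0"
    using sum sq by (simp add: sum_subtractf sum_distrib_left[symmetric])
  finally have "(\<Sum>i\<in>S. (a i - b i)^2) \<le> 0"
    using sum_nonneg[of S "\<lambda>i. (b i - c) * (a i - b i)"] c by force
  hence "(\<Sum>i\<in>S. (a i - b i)^2) = 0"
    by (simp add: antisym sum_nonneg)
  thus ?thesis using assms(1,5) by (simp add: sum_nonneg_eq_0_iff)
qed

text \<open>With \<open>c = s'\<close>, the factor \<open>b i - c\<close> vanishes on the first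
  \<open>k'\<close> entries; at \<open>Suc k'\<close> the left entry is at least \<open>t'\<close>,
  and after that both entries are 1.\<close>

lemma cluster_unique:
  assumes "k \<le> k'" and "s' \<le> t'" "t' \<le> 1"
    and sum: "(\<Sum>i=1..n. cluster k s t i) = (\<Sum>i=1..n. cluster k' s' t' i)"
    and sq: "(\<Sum>i=1..n. cluster k s t i ^ 2) = (\<Sum>i=1..n. cluster k' s' t' i ^ 2)"
    and "k = k' \<Longrightarrow> t' \<le> t" and "i \<in> {1..n}"
  shows "cluster k s t i = cluster k' s' t' i"
  by (rule sums_eq_imp_eq[OF _ sum sq, where c = s'])
    (use assms in \<open>auto simp: cluster_def\<close>)

section \<open>Fibres of the projection to the first two coordinates\<close>

lemma A3_I: "t \<in> {1..n} \<rightarrow> {-1..1} \<Longrightarrow> (\<Sum>i=1..n. twisted_cubic (t i)) \<in> A3 n"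
  unfolding A3_def by blast

text \<open>This writes \<open>A3\<close> as an iterated Minkowski sum, so that compactness follows
  by induction.\<close>

lemma A3_Suc: "A3 (Suc n) = {a + b | a b. a \<in> A3 n \<and> b \<in> twisted_cubic ` {-1..1}}"
proof (intro equalityI subsetI)
  fix p assume "p \<in> A3 (Suc n)"
  then obtain t where t: "t \<in> {1..Suc n} \<rightarrow> {-1..1}" "p = (\<Sum>i=1..Suc n. twisted_cubic (t i))"
    by (auto simp: A3_def)
  hence "p = (\<Sum>i=1..n. twisted_cubic (t i)) + twisted_cubic (t (Suc n))" by simp
  moreover have "(\<Sum>i=1..n. twisted_cubic (t i)) \<in> A3 n" using t(1) by (intro A3_I) auto
  moreover have "t (Suc n) \<in> {-1..1}" using t(1) by force
  ultimately show "p \<in> {a + b | a b. a \<in> A3 n \<and> b \<in> twisted_cubic ` {-1..1}}" by blast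
next
  fix p assume "p \<in> {a + b | a b. a \<in> A3 n \<and> b \<in> twisted_cubic ` {-1..1}}"
  then obtain t s where t: "t \<in> {1..n} \<rightarrow> {-1..1}" and s: "s \<in> {-1..1}"
    and p: "p = (\<Sum>i=1..n. twisted_cubic (t i)) + twisted_cubic s"
    unfolding A3_def by blast
  let ?t = "t(Suc n := s)"
  have "(\<Sum>i=1..n. twisted_cubic (?t i)) = (\<Sum>i=1..n. twisted_cubic (t i))"
    by (rule sum.cong) auto
  hence "p = (\<Sum>i=1..Suc n. twisted_cubic (?t i))" using p by simp
  moreover have "?t \<in> {1..Suc n} \<rightarrow> {-1..1}" using t s by (auto simp: Pi_iff)
  ultimately show "p \<in> A3 (Suc n)" unfolding A3_def by blast
qed

lemma compact_A3: "compact (A3 n)"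
proof (induction n)
  case 0
  have "A3 0 = {0}" by (auto simp: A3_def)
  thus ?case by simp
next
  case (Suc n)
  have "compact (twisted_cubic ` {-1..1})"
    unfolding twisted_cubic_def by (intro compact_continuous_image continuous_intros compact_Icc)
  with Suc show ?case unfolding A3_Suc by (intro compact_sums)
qed

lemma compact_fibre_A3: "compact {z. (x, y, z) \<in> A3 n}"
proof -
  have "closed ({x} \<times> {y} \<times> (UNIV :: real set))" by (intro closed_Times) auto
  hence "compact ((snd \<circ> snd) ` (A3 n \<inter> {x} \<times> {y} \<times> UNIV))"
    by (intro compact_continuous_image compact_Int_closed compact_A3) (auto intro!: continuous_intros)
  also have "(snd \<circ> snd) ` (A3 n \<inter> {x} \<times> {y} \<times> UNIV) = {z. (x, y, z) \<in> A3 n}"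
    by force
  finally show ?thesis .
qed

section \<open>Highest points of the fibres\<close>

definition fibre_max :: "nat \<Rightarrow> real \<Rightarrow> real \<Rightarrow> real \<Rightarrow> bool" where
  "fibre_max n x y z \<longleftrightarrow> (x, y, z) \<in> A3 n \<and> (\<forall>z'. (x, y, z') \<in> A3 n \<longrightarrow> z' \<le> z)"

lemma fibre_max_exists:
  assumes "(x, y, z) \<in> A3 n"
  shows "\<exists>z. fibre_max n x y z"
  using compact_attains_sup[OF compact_fibre_A3[of x y n]] assms by (auto simp: fibre_max_def)

lemma fibre_max_unique: "fibre_max n x y z \<Longrightarrow> fibre_max n x y z' \<Longrightarrow> z = z'"
  by (simp add: fibre_max_def antisym)

lemma fibre_max_not_raisable:
  assumes "fibre_max n (\<Sum>i=1..n. t i) (\<Sum>i=1..n. t i ^ 2) (\<Sum>i=1..n. t i ^ 3)"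
    "t \<in> {1..n} \<rightarrow> {-1..1}"
  shows "\<not> raisable n t"
  using raisable_imp_higher[of t n 1] assms by (force simp: fibre_max_def)

lemma B_plus_iff_cluster:
  "p \<in> B_plus n \<longleftrightarrow> (\<exists>k\<in>{1..n-1}. \<exists>s t. -1 \<le> s \<and> s \<le> t \<and> t \<le> 1 \<and>
     p = (\<Sum>i=1..n. twisted_cubic (cluster k s t i)))"
proof -
  have eq: "(\<Sum>i=1..n. twisted_cubic (cluster k s t i)) =
      real k *\<^sub>R twisted_cubic s + twisted_cubic t + real (n - k - 1) *\<^sub>R (1, 1, 1)"
    if "k \<in> {1..n-1}" for k s t
  proof -
    have "k < n" "twisted_cubic 1 = (1, 1, 1)" using that by (auto simp: twisted_cubic_def)
    with sum_cluster[of k n twisted_cubic s t] show ?thesis by metis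
  qed
  show ?thesis unfolding B_plus_def C_plus_def using eq by auto
qed

lemma cluster_in_cube:
  "-1 \<le> s \<Longrightarrow> s \<le> t \<Longrightarrow> t \<le> 1 \<Longrightarrow> cluster k s t \<in> S \<rightarrow> {-1..1}"
  by (auto simp: cluster_def)

lemma not_raisable_imp_B_plus:
  assumes "t \<in> {1..n} \<rightarrow> {-1..1}" "\<not> raisable n t" "n \<ge> 2"
  shows "(\<Sum>i=1..n. twisted_cubic (t i)) \<in> B_plus n"
proof -
  obtain k s r p where *: "k \<in> {1..n-1}" "-1 \<le> s" "s \<le> r" "r \<le> 1" "p permutes {1..n}"
      "\<forall>i\<in>{1..n}. t i = cluster k s r (p i)"
    using not_raisable_imp_cluster[OF assms] by metis
  have "(\<Sum>i=1..n. twisted_cubic (t i)) = (\<Sum>i=1..n. twisted_cubic (cluster k s r (p i)))"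
    by (rule sum.cong) (use * in auto)
  also have "\<dots> = (\<Sum>i=1..n. twisted_cubic (cluster k s r i))"
    using sum.permute[OF *(5), of "\<lambda>i. twisted_cubic (cluster k s r i)"] by (simp add: o_def)
  finally show ?thesis using * unfolding B_plus_iff_cluster by blast
qed

text \<open>Exchanging the two clusters if necessary brings them into the order required by
  \<open>cluster_unique\<close>.\<close>

lemma cluster_unique':
  assumes "s \<le> t" "t \<le> 1" "s' \<le> t'" "t' \<le> 1"
    and "(\<Sum>i=1..n. cluster k s t i) = (\<Sum>i=1..n. cluster k' s' t' i)"
    and "(\<Sum>i=1..n. cluster k s t i ^ 2) = (\<Sum>i=1..n. cluster k' s' t' i ^ 2)"
    and "i \<in> {1..n}"
  shows "cluster k s t i = cluster k' s' t' i"
proof -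
  consider "k < k'" | "k' < k" | "k = k'" "t' \<le> t" | "k = k'" "t \<le> t'" by linarith
  thus ?thesis
  proof cases
    case 1
    thus ?thesis using cluster_unique[of k k' s' t' s t n i] assms by simp
  next
    case 2
    thus ?thesis using cluster_unique[of k' k s t s' t' n i] assms by simp
  next
    case 3
    thus ?thesis using cluster_unique[of k k' s' t' s t n i] assms by simp
  next
    case 4
    thus ?thesis using cluster_unique[of k' k s t s' t' n i] assms by simp
  qed
qed

text \<open>By compactness the fibre has a highest point, and it comes from a cluster because its
  tuple is not raisable. A cluster is determined by its first two power sums, so the given point is
  that highest point.\<close>

lemma B_plus_imp_fibre_max:
  assumes "(x, y, z) \<in> B_plus n" and n: "n \<ge> 2"
  shows "fibre_max n x y z"
proof -
  obtain k s t where kst: "k \<in> {1..n-1}" "-1 \<le> s" "s \<le> t" "t \<le> 1"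
      "(x, y, z) = (\<Sum>i=1..n. twisted_cubic (cluster k s t i))"
    using assms unfolding B_plus_iff_cluster by blast
  have "(x, y, z) \<in> A3 n"
    unfolding kst(5) by (intro A3_I cluster_in_cube kst)
  then obtain z' where z': "fibre_max n x y z'" using fibre_max_exists by blast
  then obtain u where u: "u \<in> {1..n} \<rightarrow> {-1..1}" "(\<Sum>i=1..n. u i) = x"
      "(\<Sum>i=1..n. u i ^ 2) = y" "(\<Sum>i=1..n. u i ^ 3) = z'"
    unfolding fibre_max_def A3_iff by blast
  hence "\<not> raisable n u" using z' fibre_max_not_raisable by blast
  hence "(\<Sum>i=1..n. twisted_cubic (u i)) \<in> B_plus n"
    using not_raisable_imp_B_plus u(1) n by blast
  hence "(x, y, z') \<in> B_plus n" using u by (simp add: sum_twisted_cubic)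
  then obtain k' s' t' where kst': "s' \<le> t'" "t' \<le> 1"
      "(x, y, z') = (\<Sum>i=1..n. twisted_cubic (cluster k' s' t' i))"
    unfolding B_plus_iff_cluster by blast
  have "cluster k s t i = cluster k' s' t' i" if "i \<in> {1..n}" for i
    by (rule cluster_unique'[OF kst(3,4) kst'(1,2) _ _ that])
      (use kst(5) kst'(3) in \<open>auto simp: sum_twisted_cubic\<close>)
  hence "(x, y, z) = (x, y, z')" unfolding kst(5) kst'(3) by (intro sum.cong) auto
  thus ?thesis using z' by simp
qed

lemma B_plus_iff_fibre_max:
  assumes "n \<ge> 2"
  shows "(x, y, z) \<in> B_plus n \<longleftrightarrow> fibre_max n x y z"
proof
  assume max: "fibre_max n x y z"
  then obtain u where u: "u \<in> {1..n} \<rightarrow> {-1..1}" "(\<Sum>i=1..n. u i) = x"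
      "(\<Sum>i=1..n. u i ^ 2) = y" "(\<Sum>i=1..n. u i ^ 3) = z"
    unfolding fibre_max_def A3_iff by blast
  hence "\<not> raisable n u" using max fibre_max_not_raisable by blast
  hence "(\<Sum>i=1..n. twisted_cubic (u i)) \<in> B_plus n"
    using not_raisable_imp_B_plus u(1) assms by blast
  thus "(x, y, z) \<in> B_plus n" using u by (simp add: sum_twisted_cubic)
qed (use B_plus_imp_fibre_max assms in blast)

text \<open>If some value between \<open>z\<close> and the maximum of the fibre were missing, the largest
  attained value below the gap would be a nonmaximal point that cannot be raised slightly.\<close>

lemma fibre_interval:
  assumes n: "n \<ge> 2" and z0: "(x, y, z0) \<in> A3 n" and z1: "(x, y, z1) \<in> A3 n"
    and z: "z0 \<le> z" "z \<le> z1"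
  shows "(x, y, z) \<in> A3 n"
proof -
  let ?F = "{z. (x, y, z) \<in> A3 n} \<inter> {..z}"
  have "compact ?F" by (intro compact_Int_closed compact_fibre_A3) auto
  moreover have "?F \<noteq> {}" using z0 z by auto
  ultimately obtain m where m: "(x, y, m) \<in> A3 n" "m \<le> z"
      and m_max: "\<And>z'. (x, y, z') \<in> A3 n \<Longrightarrow> z' \<le> z \<Longrightarrow> z' \<le> m"
    using compact_attains_sup[of ?F] by auto
  show ?thesis
  proof (cases "m = z")
    case False
    hence "m < z" using m by simp
    obtain u where u: "u \<in> {1..n} \<rightarrow> {-1..1}" "(\<Sum>i=1..n. u i) = x"
        "(\<Sum>i=1..n. u i ^ 2) = y" "(\<Sum>i=1..n. u i ^ 3) = m"
      using m(1) unfolding A3_iff by blast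
    have "\<not> fibre_max n x y m" using z1 z \<open>m < z\<close> by (auto simp: fibre_max_def)
    hence "raisable n u"
      using not_raisable_imp_B_plus[OF u(1) _ n] u n
      by (auto simp: sum_twisted_cubic B_plus_iff_fibre_max)
    from raisable_imp_higher[OF u(1) this, of "z - m"] \<open>m < z\<close> u
    obtain z' where "(x, y, z') \<in> A3 n" "m < z'" "z' < z" by auto
    with m_max[of z'] show ?thesis by simp
  qed (use m in simp)
qed

section \<open>The symmetry that exchanges highest and lowest points\<close>

definition reflect :: "real \<times> real \<times> real \<Rightarrow> real \<times> real \<times> real" where
  "reflect = (\<lambda>(x, y, z). (- x, y, - z))"

lemma reflect_simps [simp]: "reflect (x, y, z) = (- x, y, - z)" "reflect (reflect p) = p"
  "reflect (p + q) = reflect p + reflect q" "reflect (c *\<^sub>R p) = c *\<^sub>R reflect p"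
  "reflect (twisted_cubic t) = twisted_cubic (- t)"
  by (auto simp: reflect_def twisted_cubic_def split: prod.splits)

lemma reflect_sum: "reflect (\<Sum>i\<in>S. twisted_cubic (t i)) = (\<Sum>i\<in>S. twisted_cubic (- t i))"
  by (simp add: sum_twisted_cubic sum_negf)

lemma reflect_A3: "reflect p \<in> A3 n \<longleftrightarrow> p \<in> A3 n"
proof -
  have "reflect p \<in> A3 n" if "p \<in> A3 n" for p
  proof -
    obtain t where t: "t \<in> {1..n} \<rightarrow> {-1..1}" "p = (\<Sum>i=1..n. twisted_cubic (t i))"
      using \<open>p \<in> A3 n\<close> by (auto simp: A3_def)
    have "(\<lambda>i. - t i) \<in> {1..n} \<rightarrow> {-1..1}" using t(1) by (force simp: Pi_iff)
    thus ?thesis unfolding t(2) reflect_sum by (rule A3_I)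
  qed
  from this[of p] this[of "reflect p"] show ?thesis by auto
qed

text \<open>Negation reverses \<open>s \<le> t\<close>, so the parameters become
  \<open>-t \<le> -s\<close> and the entry of multiplicity \<open>k\<close> changes from the larger
  to the smaller one.\<close>

lemma reflect_C_minus: "reflect p \<in> C_plus k a \<longleftrightarrow> p \<in> C_minus k a"
proof
  assume "reflect p \<in> C_plus k a"
  then obtain s t where *: "-1 \<le> s" "s \<le> t" "t \<le> 1"
    "reflect p = real k *\<^sub>R twisted_cubic s + twisted_cubic t + real a *\<^sub>R (1, 1, 1)"
    by (auto simp: C_plus_def)
  have "p = reflect (reflect p)" by simp
  also have "\<dots> = twisted_cubic (- t) + real k *\<^sub>R twisted_cubic (- s) + real a *\<^sub>R (-1, 1, -1)"
    unfolding *(4) by (simp only: reflect_simps) (simp add: add_ac)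
  finally have "\<exists>s t. p = twisted_cubic s + real k *\<^sub>R twisted_cubic t + real a *\<^sub>R (-1, 1, -1) \<and>
      -1 \<le> s \<and> s \<le> t \<and> t \<le> 1"
    using * by (intro exI[of _ "- t"] exI[of _ "- s"]) simp
  thus "p \<in> C_minus k a" unfolding C_minus_def by blast
next
  assume "p \<in> C_minus k a"
  then obtain s t where *: "-1 \<le> s" "s \<le> t" "t \<le> 1"
    "p = twisted_cubic s + real k *\<^sub>R twisted_cubic t + real a *\<^sub>R (-1, 1, -1)"
    by (auto simp: C_minus_def)
  have "reflect p = real k *\<^sub>R twisted_cubic (- t) + twisted_cubic (- s) + real a *\<^sub>R (1, 1, 1)"
    unfolding *(4) by (simp only: reflect_simps) (simp add: add_ac)
  hence "\<exists>s t. reflect p = real k *\<^sub>R twisted_cubic s + twisted_cubic t + real a *\<^sub>R (1, 1, 1) \<and>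
      -1 \<le> s \<and> s \<le> t \<and> t \<le> 1"
    using * by (intro exI[of _ "- t"] exI[of _ "- s"]) simp
  thus "reflect p \<in> C_plus k a" unfolding C_plus_def by blast
qed

lemma reflect_B_minus: "p \<in> B_minus n \<longleftrightarrow> reflect p \<in> B_plus n"
  by (auto simp: B_minus_def B_plus_def reflect_C_minus)

lemma B_minus_iff:
  assumes "n \<ge> 2"
  shows "(x, y, z) \<in> B_minus n \<longleftrightarrow> (x, y, z) \<in> A3 n \<and> (\<forall>z'. (x, y, z') \<in> A3 n \<longrightarrow> z \<le> z')"
proof -
  have "(- x, y, z') \<in> A3 n \<longleftrightarrow> (x, y, - z') \<in> A3 n" for z'
    using reflect_A3[of "(x, y, - z')" n] by simp
  thus ?thesis
    unfolding reflect_B_minus reflect_simps B_plus_iff_fibre_max[OF assms] fibre_max_def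
    by (metis minus_minus neg_le_iff_le)
qed

section \<open>The planar projection\<close>

text \<open>The difference of the two sides is affine in each \<open>t i\<close>, so it suffices to look at
  \<open>t i \<in> {-1, 1}\<close>, where \<open>(\<Sum>i. t i) - c\<close> is an odd integer.\<close>

lemma sum_squares_le:
  assumes "t \<in> {1..n} \<rightarrow> {-1..1::real}" "odd (c + int n)"
  shows "(\<Sum>i=1..n. t i ^ 2) \<le> real n - 1 + ((\<Sum>i=1..n. t i) - of_int c)^2"
  using assms
proof (induction n arbitrary: c)
  case 0
  hence "c \<noteq> 0" by auto
  hence "1 \<le> \<bar>c\<bar>" by simp
  hence "1 \<le> \<bar>real_of_int c\<bar>" by linarith
  hence "1 \<le> (real_of_int c)^2" by (metis abs_1 abs_le_square_iff power_one)
  thus ?case by simp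
next
  case (Suc n)
  define d where "d = (\<Sum>i=1..n. t i) - of_int c"
  define v where "v = t (Suc n)"
  have "t \<in> {1..n} \<rightarrow> {-1..1}" using Suc.prems by auto
  \<comment> \<open>Both shifts of \<open>c\<close> restore the parity. They are the cases where the
    last entry is 1 or -1; together they bound the sum by \<open>n + d^2 - 2 * |d|\<close>.\<close>
  with Suc.IH[of "c - 1"] Suc.IH[of "c + 1"] Suc.prems(2)
  have *: "(\<Sum>i=1..n. t i ^ 2) \<le> real n - 1 + (d + 1)^2"
    "(\<Sum>i=1..n. t i ^ 2) \<le> real n - 1 + (d - 1)^2"
    by (auto simp: d_def algebra_simps)
  have "v \<in> {-1..1}" using Suc.prems(1) unfolding v_def by force
  hence "\<bar>v\<bar> \<le> 1" by auto
  hence "\<bar>d * v\<bar> \<le> \<bar>d\<bar>" by (simp add: abs_mult mult_left_le)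
  with * have "(\<Sum>i=1..n. t i ^ 2) + v^2 \<le> real n + (d + v)^2"
    by (simp add: power2_eq_square algebra_simps)
  thus ?case by (simp add: v_def d_def algebra_simps)
qed

lemma sums_in_B_flat:
  assumes t: "t \<in> {1..n} \<rightarrow> {-1..1}"
  shows "(\<Sum>i=1..n. t i, \<Sum>i=1..n. t i ^ 2) \<in> B_flat n"
proof -
  have "\<bar>\<Sum>i=1..n. t i\<bar> \<le> (\<Sum>i=1..n. \<bar>t i\<bar>)" by (rule sum_abs)
  also have "\<dots> \<le> (\<Sum>i=1..n. 1)" using t by (intro sum_mono) (force simp: abs_le_iff)
  finally have "\<bar>\<Sum>i=1..n. t i\<bar> \<le> real n" by simp
  moreover have "(\<Sum>i=1..n. t i)^2 \<le> real n * (\<Sum>i=1..n. t i ^ 2)"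
    using sum_squared_le_sum_of_squares[of t "{1..n}"] by (simp add: mult.commute)
  \<comment> \<open>For \<open>c = n - 1 - 2 * i\<close> the number
    \<open>c + n = 2 * (n - i) - 1\<close> is odd.\<close>
  moreover have "(\<Sum>m=1..n. t m ^ 2) \<le>
      (real n - 1) + ((\<Sum>m=1..n. t m) + 2 * real i - (real n - 1))^2" for i
    using sum_squares_le[OF t, of "int n - 1 - 2 * int i"] by (simp add: algebra_simps)
  ultimately show ?thesis by (simp add: B_flat_def)
qed

text \<open>At fixed \<open>\<Sum>i. t i = x\<close>, the sum of squares varies continuously between its value at the
  constant tuple and its value at a tuple with at most one entry in \<open>(-1, 1)\<close>.\<close>

lemma B_flat_imp_sums:
  assumes xy: "(x, y) \<in> B_flat n" and n: "n \<ge> 1"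
  obtains t where "t \<in> {1..n} \<rightarrow> {-1..1}" "(\<Sum>i=1..n. t i) = x" "(\<Sum>i=1..n. t i ^ 2) = y"
proof -
  have x: "\<bar>x\<bar> \<le> real n" and lower: "x^2 \<le> real n * y"
    and upper: "\<And>i. i < n \<Longrightarrow> y \<le> (real n - 1) + (x + 2 * real i - (real n - 1))^2"
    using xy n by (auto simp: B_flat_def)
  \<comment> \<open>A tuple with \<open>i\<close> entries -1, one entry \<open>r\<close> and all
    others 1 has sum \<open>x\<close> for this \<open>r\<close>. The floor puts \<open>r\<close>
    into the interval; the cap \<open>n - 1\<close> takes effect only at \<open>x = -n\<close>,
    where \<open>r = -1\<close>.\<close>
  define i where "i = min (n - 1) (nat \<lfloor>(real n - x) / 2\<rfloor>)"
  define r where "r = x + 2 * real i - (real n - 1)"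
  have i: "i < n" using n by (auto simp: i_def)
  have r: "r \<in> {-1..1}"
  proof (cases "n - 1 \<le> nat \<lfloor>(real n - x) / 2\<rfloor>")
    case True
    hence "i = n - 1" by (simp add: i_def)
    hence ri: "r = x + real n - 1" using n by (simp add: r_def of_nat_diff)
    have "int (n - 1) \<le> \<lfloor>(real n - x) / 2\<rfloor>" using True x by (simp add: le_nat_iff)
    hence "real n - 1 \<le> (real n - x) / 2" using n by (simp add: le_floor_iff of_nat_diff)
    thus ?thesis using ri x by simp
  next
    case False
    hence "real i = of_int \<lfloor>(real n - x) / 2\<rfloor>" using x by (simp add: i_def)
    hence "real i \<le> (real n - x) / 2" "(real n - x) / 2 < real i + 1"
      by (simp_all only: of_int_floor_le real_of_int_floor_add_one_gt)
    thus ?thesis by (simp add: r_def)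
  qed
  define V where "V = cluster i (-1) r"
  have V: "V \<in> {1..n} \<rightarrow> {-1..1}" using r unfolding V_def by (intro cluster_in_cube) auto
  have V1: "(\<Sum>m=1..n. V m) = x"
    using sum_cluster[OF i, of "\<lambda>x. x" "-1" r] i by (simp add: V_def r_def of_nat_diff)
  have V2: "(\<Sum>m=1..n. V m ^ 2) = real n - 1 + r^2"
    using sum_cluster[OF i, of "\<lambda>x. x^2" "-1" r] i by (simp add: V_def of_nat_diff)
  define g where "g l = (\<Sum>m=1..n. ((1 - l) * (x / real n) + l * V m)^2)" for l
  have "g 0 = x^2 / real n" using n by (simp add: g_def power2_eq_square field_simps)
  hence "g 0 \<le> y" using lower n by (simp add: divide_le_eq mult.commute)
  moreover have "y \<le> g 1" using upper[OF i] V2 by (simp add: g_def r_def)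
  moreover have "continuous_on {0..1} g" unfolding g_def by (intro continuous_intros)
  ultimately obtain l where l: "0 \<le> l" "l \<le> 1" "g l = y" using IVT'[of g 0 y 1] by auto
  define t where "t m = (1 - l) * (x / real n) + l * V m" for m
  have "t m \<in> {-1..1}" if "m \<in> {1..n}" for m
  proof -
    have "\<bar>x / real n\<bar> \<le> 1" using x n by simp
    hence a: "x / real n \<in> {-1..1}" unfolding atLeastAtMost_iff by linarith
    have b: "V m \<in> {-1..1}" using V that by blast
    have "(1 - l) *\<^sub>R (x / real n) + l *\<^sub>R V m \<in> {-1..1}"
      by (rule convexD[OF convex_real_interval(5) a b]) (use l in auto)
    thus ?thesis by (simp add: t_def)
  qed
  moreover have "(\<Sum>m=1..n. t m) = x"
    unfolding t_def sum.distrib sum_distrib_left[symmetric] V1 using n by (simp add: field_simps)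
  moreover have "(\<Sum>m=1..n. t m ^ 2) = y" using l by (simp add: t_def g_def)
  ultimately show thesis by (intro that) auto
qed

lemma B_flat_iff_fibre:
  assumes "n \<ge> 1"
  shows "(x, y) \<in> B_flat n \<longleftrightarrow> (\<exists>z. (x, y, z) \<in> A3 n)"
proof
  assume "(x, y) \<in> B_flat n"
  then obtain t where "t \<in> {1..n} \<rightarrow> {-1..1}" "(\<Sum>i=1..n. t i) = x" "(\<Sum>i=1..n. t i ^ 2) = y"
    using B_flat_imp_sums assms by blast
  thus "\<exists>z. (x, y, z) \<in> A3 n" unfolding A3_iff by blast
next
  assume "\<exists>z. (x, y, z) \<in> A3 n"
  thus "(x, y) \<in> B_flat n" unfolding A3_iff using sums_in_B_flat by blast
qed

lemma closed_B_flat: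
  assumes "n \<ge> 1"
  shows "closed (B_flat n)"
proof -
  have "B_flat n = (\<lambda>p. (fst p, fst (snd p))) ` A3 n"
    using B_flat_iff_fibre[OF assms] by force
  also have "compact \<dots>" by (intro compact_continuous_image continuous_intros compact_A3)
  finally show ?thesis by (rule compact_imp_closed)
qed

section \<open>The boundary of \<open>B_flat n\<close> and the tuples above it\<close>

definition on_bounding_parabola :: "nat \<Rightarrow> real \<Rightarrow> real \<Rightarrow> bool" where
  "on_bounding_parabola n x y \<longleftrightarrow> real n * y = x^2 \<or>
     (\<exists>i\<in>{0..n-1}. y = (real n - 1) + (x + 2 * real i - (real n - 1))^2)"

lemma interior_shift:
  assumes "p \<in> interior S" "norm v = 1"
  obtains e :: real where "e > 0" "p + e *\<^sub>R v \<in> S" "p - e *\<^sub>R v \<in> S"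
proof -
  obtain d where "d > 0" and d: "ball p d \<subseteq> S" using assms(1) by (auto simp: mem_interior)
  have "p + (d / 2) *\<^sub>R v \<in> ball p d" "p - (d / 2) *\<^sub>R v \<in> ball p d"
    using \<open>d > 0\<close> assms(2) by (auto simp: dist_norm)
  with d \<open>d > 0\<close> that[of "d / 2"] show thesis by (meson half_gt_zero subsetD)
qed

text \<open>Where a quadratic bound is tight, one of two opposite vertical moves violates it. Where
  all of them are strict, so is \<open>|x| < n\<close>, and the strict inequalities define an open
  set.\<close>

lemma frontier_B_flat:
  assumes xy: "(x, y) \<in> B_flat n" and n: "n \<ge> 1"
  shows "(x, y) \<in> frontier (B_flat n) \<longleftrightarrow> on_bounding_parabola n x y"
proof -
  let ?q = "\<lambda>i x. (real n - 1) + (x + 2 * real i - (real n - 1))^2"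
  have "(x, y) \<in> interior (B_flat n) \<longleftrightarrow> \<not> on_bounding_parabola n x y"
  proof
    assume "(x, y) \<in> interior (B_flat n)"
    then obtain e where e: "e > 0" "(x, y) + e *\<^sub>R (0, 1) \<in> B_flat n" "(x, y) - e *\<^sub>R (0, 1) \<in> B_flat n"
      by (rule interior_shift[where v = "(0, 1)"]) (auto simp: norm_Pair)
    hence "x^2 \<le> real n * (y - e)" "\<And>i. i \<in> {0..n-1} \<Longrightarrow> y + e \<le> ?q i x"
      by (auto simp: B_flat_def)
    moreover have "real n * (y - e) < real n * y" using e n by simp
    ultimately show "\<not> on_bounding_parabola n x y"
      using e(1) unfolding on_bounding_parabola_def by force
  next
    assume not: "\<not> on_bounding_parabola n x y"
    define U where "U = {p. \<bar>fst p\<bar> < real n} \<inter> {p. (fst p)^2 < real n * snd p} \<inter>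
      (\<Inter>i\<in>{0..n-1}. {p. snd p < ?q i (fst p)})"
    have "open U" unfolding U_def
      by (intro open_Int open_INT ballI finite_atLeastAtMost open_Collect_less continuous_intros)
    moreover have "U \<subseteq> B_flat n" by (auto simp: U_def B_flat_def intro: less_imp_le)
    moreover have "(x, y) \<in> U"
    proof -
      have low: "x^2 < real n * y" and up: "\<And>i. i \<in> {0..n-1} \<Longrightarrow> y < ?q i x"
        using xy not by (auto simp: B_flat_def on_bounding_parabola_def less_le)
      \<comment> \<open>At \<open>|x| = n\<close> the lower bound would give \<open>y > n\<close>,
        but the upper bound for \<open>i = 0\<close> or \<open>i = n - 1\<close> gives
        \<open>y < n\<close>.\<close>
      have "\<bar>x\<bar> \<noteq> real n"
      proof
        assume "\<bar>x\<bar> = real n"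
        hence x: "x = real n \<or> x = - real n" by linarith
        hence "real n * real n < real n * y" using low by (auto simp: power2_eq_square)
        hence "real n < y" using n by simp
        moreover have "y < real n" using x
        proof
          assume "x = real n" thus ?thesis using up[of 0] by simp
        next
          assume "x = - real n" thus ?thesis using up[of "n - 1"] n by (simp add: of_nat_diff)
        qed
        ultimately show False by simp
      qed
      thus ?thesis using low up xy by (auto simp: U_def B_flat_def)
    qed
    ultimately show "(x, y) \<in> interior (B_flat n)" by (meson interiorI)
  qed
  thus ?thesis using xy closed_B_flat[OF n] by (auto simp: frontier_def)
qed

text \<open>If \<open>N\<close> of the entries other than \<open>t j\<close> are -1, the sum is
  \<open>t j + n - 1 - 2 * N\<close> and the sum of squares is \<open>n - 1 + t j ^ 2\<close>. This
  is the upper parabola with index \<open>N\<close>.\<close>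

lemma parabola_of_single_interior_entry:
  assumes t: "t \<in> {1..n} \<rightarrow> {-1..1}" and n: "n \<ge> 1"
    and single: "\<And>j k. j \<in> {1..n} \<Longrightarrow> k \<in> {1..n} \<Longrightarrow> t j \<in> {-1<..<1} \<Longrightarrow> t k \<in> {-1<..<1} \<Longrightarrow> j = k"
  shows "on_bounding_parabola n (\<Sum>i=1..n. t i) (\<Sum>i=1..n. t i ^ 2)"
proof -
  obtain j where j: "j \<in> {1..n}" and ends: "\<And>m. m \<in> {1..n} - {j} \<Longrightarrow> t m \<notin> {-1<..<1}"
  proof (cases "\<exists>j\<in>{1..n}. t j \<in> {-1<..<1}")
    case True
    thus thesis using that single by blast
  next
    case False
    thus thesis using that[of 1] n by auto
  qed
  let ?S = "{1..n} - {j}" and ?N = "{m \<in> {1..n} - {j}. t m = -1}"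
  have pm: "t m = 1 \<or> t m = -1" if "m \<in> ?S" for m
    using ends[OF that] t that by (force simp: Pi_iff)
  have card: "card ?S = n - 1" using j by simp
  hence "card ?N \<le> n - 1" by (metis (no_types, lifting) card_mono finite_Diff finite_atLeastAtMost mem_Collect_eq subsetI)
  have "(\<Sum>m\<in>?S. t m) = (\<Sum>m\<in>?S. 1 - 2 * (if t m = -1 then 1 else 0))"
    by (rule sum.cong) (use pm in auto)
  also have "\<dots> = real (n - 1) - 2 * real (card ?N)"
    unfolding sum_subtractf sum_distrib_left[symmetric] using j by (simp add: sum.If_cases Int_def)
  finally have s1: "(\<Sum>m=1..n. t m) = t j + (real n - 1 - 2 * real (card ?N))"
    using j n by (simp add: sum.remove[of _ j] of_nat_diff)
  have "(\<Sum>m\<in>?S. t m ^ 2) = (\<Sum>m\<in>?S. 1)"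
    by (rule sum.cong) (use pm in \<open>auto simp: power2_eq_1_iff\<close>)
  hence "(\<Sum>m=1..n. t m ^ 2) = real n - 1 + t j ^ 2"
    using j n card by (simp add: sum.remove[of _ j] of_nat_diff)
  also have "t j = (\<Sum>m=1..n. t m) + 2 * real (card ?N) - (real n - 1)" using s1 by simp
  finally show ?thesis using \<open>card ?N \<le> n - 1\<close> unfolding on_bounding_parabola_def by auto
qed

text \<open>Suppose that two entries lie in the open interval. Extremality in both directions
  confines every other entry between them, and a third entry, available as \<open>n \<ge> 3\<close>,
  forces the two to be equal. So either the tuple is constant or at most one entry is
  interior.\<close>

lemma parabola_of_extremal:
  assumes t: "t \<in> {1..n} \<rightarrow> {-1..1}" and n: "n \<ge> 3"
    and up: "\<not> raisable n t" and down: "\<not> raisable n (\<lambda>i. - t i)"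
  shows "on_bounding_parabola n (\<Sum>i=1..n. t i) (\<Sum>i=1..n. t i ^ 2)"
proof (cases "\<exists>c. \<forall>i\<in>{1..n}. t i = c")
  case True
  then obtain c where "\<forall>i\<in>{1..n}. t i = c" by blast
  hence "(\<Sum>i=1..n. t i) = real n * c" "(\<Sum>i=1..n. t i ^ 2) = real n * c^2" by simp_all
  thus ?thesis by (simp add: on_bounding_parabola_def power2_eq_square)
next
  case nonconst: False
  have up': "\<not> (t i < t j \<and> t j \<le> t k \<and> t k < 1)"
    if "i \<in> {1..n}" "j \<in> {1..n}" "k \<in> {1..n}" "j \<noteq> k" for i j k
    using up that unfolding raisable_def by blast
  have down': "\<not> (t k < t i \<and> t j \<le> t k \<and> -1 < t j)"
    if "i \<in> {1..n}" "j \<in> {1..n}" "k \<in> {1..n}" "j \<noteq> k" for i j k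
  proof
    assume "t k < t i \<and> t j \<le> t k \<and> -1 < t j"
    hence "raisable n (\<lambda>i. - t i)" unfolding raisable_def using that
      by (intro bexI[of _ i] bexI[of _ k] bexI[of _ j]) auto
    thus False using down by blast
  qed
  have no_two: False
    if jk: "j \<in> {1..n}" "k \<in> {1..n}" "j \<noteq> k" "t j \<in> {-1<..<1}" "t k \<in> {-1<..<1}" "t j \<le> t k" for j k
  proof -
    have between: "t j \<le> t i \<and> t i \<le> t k" if "i \<in> {1..n}" for i
    proof -
      have "t k < 1" "-1 < t j" using jk(4,5) by auto
      thus ?thesis using up'[OF that jk(1,2,3)] down'[OF that jk(1,2,3)] jk(6) by (meson not_le)
    qed
    have "\<not> {1..n} \<subseteq> {j, k}"
    proof
      assume "{1..n} \<subseteq> {j, k}"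
      hence "card {1..n} \<le> card {j, k}" by (intro card_mono) auto
      thus False using n jk(3) by simp
    qed
    then obtain l where l: "l \<in> {1..n}" "l \<noteq> j" "l \<noteq> k" by blast
    have "t j = t k"
    proof (rule ccontr)
      assume ne: "t j \<noteq> t k"
      show False
      proof (cases "t j < t l")
        case True
        thus False using up'[OF jk(1) l(1) jk(2) l(3)] between[OF l(1)] jk by auto
      next
        case False
        thus False using down'[OF jk(2) l(1) jk(1) l(2)] down'[OF jk(2) jk(1) l(1)] l
            between[OF l(1)] jk ne by auto
      qed
    qed
    hence "\<forall>i\<in>{1..n}. t i = t j" using between by force
    with nonconst show False by blast
  qed
  show ?thesis
  proof (rule parabola_of_single_interior_entry[OF t])
    fix j k assume "j \<in> {1..n}" "k \<in> {1..n}" "t j \<in> {-1<..<1}" "t k \<in> {-1<..<1}"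
    thus "j = k" using no_two[of j k] no_two[of k j] by (cases "t j \<le> t k") auto
  qed (use n in simp)
qed

text \<open>On the lower parabola all entries are equal. On an upper one, spreading
  \<open>t j\<close> and \<open>t k\<close> apart would keep the sum and push the sum of squares
  above its bound.\<close>

lemma not_raisable_of_parabola:
  assumes t: "t \<in> {1..n} \<rightarrow> {-1..1}" and n: "n \<ge> 1"
    and par: "on_bounding_parabola n (\<Sum>i=1..n. t i) (\<Sum>i=1..n. t i ^ 2)"
  shows "\<not> raisable n t"
proof
  assume "raisable n t"
  then obtain i j k where ijk: "i \<in> {1..n}" "j \<in> {1..n}" "k \<in> {1..n}" "j \<noteq> k"
      "t i < t j" "t j \<le> t k" "t k < 1"
    unfolding raisable_def by blast
  define x where "x = (\<Sum>i=1..n. t i)"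
  from par consider "real n * (\<Sum>i=1..n. t i ^ 2) = x^2" |
    m where "m \<in> {0..n-1}" "(\<Sum>i=1..n. t i ^ 2) = (real n - 1) + (x + 2 * real m - (real n - 1))^2"
    unfolding on_bounding_parabola_def x_def by blast
  thus False
  proof cases
    case 1
    have "t m = x / real n" if "m \<in> {1..n}" for m
      by (rule sums_eq_imp_eq[where S = "{1..n}" and a = t and b = "\<lambda>_. x / real n" and c = "x / real n"])
        (use 1 n that in \<open>auto simp: x_def power2_eq_square field_simps\<close>)
    thus False using ijk by force
  next
    case (2 m)
    \<comment> \<open>The largest spread that keeps both entries in the interval; it is positive
      because \<open>-1 \<le> t i < t j\<close> and \<open>t k < 1\<close>.\<close>
    define e where "e = min (t j + 1) (1 - t k)"
    have "-1 \<le> t i" using t ijk by force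
    hence e: "e > 0" "t j - e \<ge> -1" "t k + e \<le> 1" using ijk by (auto simp: e_def)
    define t' where "t' = t(j := t j - e, k := t k + e)"
    have "t j - e \<in> {-1..1}" "t k + e \<in> {-1..1}" using e ijk by auto
    hence t': "t' \<in> {1..n} \<rightarrow> {-1..1}" using t unfolding t'_def by (auto simp: Pi_iff)
    have new: "(\<Sum>m=1..n. f (t' m)) =
        (\<Sum>m=1..n. f (t m)) - (f (t j) + f (t k)) + (f (t j - e) + f (t k + e))"
      for f :: "real \<Rightarrow> real"
      unfolding t'_def using ijk
      by (simp only: sum_fun_upd finite_atLeastAtMost) (simp add: algebra_simps)
    have "(\<Sum>m=1..n. t' m) = x" using new[of "\<lambda>x. x"] by (simp add: x_def)
    with sums_in_B_flat[OF t'] 2 have "(\<Sum>m=1..n. t' m ^ 2) \<le> (\<Sum>m=1..n. t m ^ 2)"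
      by (auto simp: B_flat_def)
    hence "e * (t k - t j) + e * e \<le> 0"
      using new[of "\<lambda>x. x^2"] by (simp add: power2_eq_square algebra_simps)
    moreover have "e * (t k - t j) \<ge> 0" "e * e > 0" using e ijk by auto
    ultimately show False by linarith
  qed
qed

section \<open>Boundary and representations\<close>

lemma closed_A3: "closed (A3 n)"
  using compact_A3 by (rule compact_imp_closed)

lemma compact_B_plus: "compact (B_plus n)"
proof -
  have "compact (C_plus k a)" for k a
  proof -
    let ?T = "{p :: real \<times> real. -1 \<le> fst p \<and> fst p \<le> snd p \<and> snd p \<le> 1}"
    have "closed ?T" by (intro closed_Collect_conj closed_Collect_le continuous_intros)
    moreover have "?T \<subseteq> {-1..1} \<times> {-1..1}" by auto
    hence "bounded ?T" by (rule bounded_subset[rotated]) (intro bounded_Times bounded_closed_interval)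
    ultimately have "compact ?T" by (simp add: compact_eq_bounded_closed)
    moreover have "C_plus k a = (\<lambda>p. real k *\<^sub>R twisted_cubic (fst p) + twisted_cubic (snd p) +
        real a *\<^sub>R (1, 1, 1)) ` ?T"
      unfolding C_plus_def set_eq_iff image_iff Bex_def mem_Collect_eq by (metis fst_conv snd_conv)
    ultimately show ?thesis
      unfolding twisted_cubic_def by (auto intro!: compact_continuous_image continuous_intros)
  qed
  thus ?thesis unfolding B_plus_def by (intro compact_UN) auto
qed

lemma B_plus_unique_fibre_point:
  assumes n: "n \<ge> 2" and "(x, y) \<in> B_flat n"
  shows "\<exists>!z. (x, y, z) \<in> B_plus n"
proof -
  have "\<exists>z. (x, y, z) \<in> A3 n" using assms B_flat_iff_fibre[of n x y] by simp
  then obtain z where "fibre_max n x y z" using fibre_max_exists by blast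
  thus ?thesis
    unfolding B_plus_iff_fibre_max[OF n] using fibre_max_unique by blast
qed

lemma reflect_B_flat:
  assumes "n \<ge> 1"
  shows "(- x, y) \<in> B_flat n \<longleftrightarrow> (x, y) \<in> B_flat n"
proof -
  have "(- x, y, - z) \<in> A3 n \<longleftrightarrow> (x, y, z) \<in> A3 n" for z
    using reflect_A3[of "(x, y, z)" n] by simp
  thus ?thesis unfolding B_flat_iff_fibre[OF assms] by (metis minus_minus)
qed

text \<open>Negating \<open>x\<close> exchanges the upper parabolas with indices \<open>i\<close>
  and \<open>n - 1 - i\<close>.\<close>

lemma reflect_on_bounding_parabola:
  assumes "on_bounding_parabola n x y" "n \<ge> 1"
  shows "on_bounding_parabola n (- x) y"
proof -
  have "- x + 2 * real (n - 1 - i) - (real n - 1) = - (x + 2 * real i - (real n - 1))"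
    if "i \<in> {0..n-1}" for i
  proof -
    have "i + 1 + (n - 1 - i) = n" using that assms(2) by auto
    hence "real i + 1 + real (n - 1 - i) = real n" by (metis of_nat_1 of_nat_add)
    thus ?thesis by simp
  qed
  hence "\<exists>j\<in>{0..n-1}. (- x + 2 * real j - (real n - 1))^2 = (x + 2 * real i - (real n - 1))^2"
    if "i \<in> {0..n-1}" for i
    using that by (intro bexI[of _ "n - 1 - i"]) (auto simp only: power2_minus atLeastAtMost_iff)
  thus ?thesis using assms(1) unfolding on_bounding_parabola_def by (metis power2_minus)
qed

lemma B_minus_unique_fibre_point:
  assumes n: "n \<ge> 2" and "(x, y) \<in> B_flat n"
  shows "\<exists>!z. (x, y, z) \<in> B_minus n"
proof -
  have "\<exists>!z. (- x, y, z) \<in> B_plus n"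
    using assms reflect_B_flat[of n x y] by (intro B_plus_unique_fibre_point) auto
  thus ?thesis unfolding reflect_B_minus reflect_simps by (metis minus_minus)
qed

lemma proj_B_plus: "n \<ge> 2 \<Longrightarrow> proj_xy ` B_plus n = B_flat n"
proof (intro equalityI subsetI)
  fix p assume n: "n \<ge> 2" and "p \<in> proj_xy ` B_plus n"
  then obtain x y z where "p = (x, y)" "(x, y, z) \<in> B_plus n" by (force simp: proj_xy_def)
  thus "p \<in> B_flat n"
    using n B_flat_iff_fibre[of n x y] by (auto simp: B_plus_iff_fibre_max fibre_max_def)
next
  fix p assume "n \<ge> 2" "p \<in> B_flat n"
  moreover obtain x y where "p = (x, y)" by force
  ultimately obtain z where "(x, y, z) \<in> B_plus n" using B_plus_unique_fibre_point by blast
  thus "p \<in> proj_xy ` B_plus n" using \<open>p = (x, y)\<close> by (force simp: proj_xy_def)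
qed

lemma proj_B_minus: "n \<ge> 2 \<Longrightarrow> proj_xy ` B_minus n = B_flat n"
proof (intro equalityI subsetI)
  fix p assume n: "n \<ge> 2" and "p \<in> proj_xy ` B_minus n"
  then obtain x y z where "p = (x, y)" "(x, y, z) \<in> B_minus n" by (force simp: proj_xy_def)
  thus "p \<in> B_flat n" using n B_flat_iff_fibre[of n x y] by (auto simp: B_minus_iff)
next
  fix p assume "n \<ge> 2" "p \<in> B_flat n"
  moreover obtain x y where "p = (x, y)" by force
  ultimately obtain z where "(x, y, z) \<in> B_minus n" using B_minus_unique_fibre_point by blast
  thus "p \<in> proj_xy ` B_minus n" using \<open>p = (x, y)\<close> by (force simp: proj_xy_def)
qed

text \<open>Take a tuple \<open>t\<close> of the highest point. The fibre is a single point exactly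
  when \<open>-t\<close> is highest over \<open>(-x, y)\<close> too, so the question is whether both
  \<open>t\<close> and \<open>-t\<close> resist raising.\<close>

lemma B_plus_meets_B_minus_iff:
  assumes n: "n \<ge> 3" and zp: "(x, y, zp) \<in> B_plus n" and zm: "(x, y, zm) \<in> B_minus n"
  shows "zp = zm \<longleftrightarrow> (x, y) \<in> frontier (B_flat n)"
proof -
  have max: "fibre_max n x y zp" using zp n B_plus_iff_fibre_max by simp
  then obtain t where t: "t \<in> {1..n} \<rightarrow> {-1..1}" and x: "(\<Sum>i=1..n. t i) = x"
      and y: "(\<Sum>i=1..n. t i ^ 2) = y" and z: "(\<Sum>i=1..n. t i ^ 3) = zp"
    unfolding fibre_max_def A3_iff by blast
  have t': "(\<lambda>i. - t i) \<in> {1..n} \<rightarrow> {-1..1}" using t by (force simp: Pi_iff)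
  have sums': "(\<Sum>i=1..n. - t i) = - x" "(\<Sum>i=1..n. (- t i) ^ 2) = y" "(\<Sum>i=1..n. (- t i) ^ 3) = - zp"
    using x y z by (simp_all add: sum_negf)
  have xy: "(x, y) \<in> B_flat n" using sums_in_B_flat[OF t] x y by simp
  have iff: "(x, y) \<in> frontier (B_flat n) \<longleftrightarrow> on_bounding_parabola n x y"
    using frontier_B_flat[OF xy] n by simp
  show ?thesis
  proof
    assume "zp = zm"
    hence "fibre_max n (- x) y (- zp)"
      using zm n by (simp add: reflect_B_minus B_plus_iff_fibre_max)
    hence "\<not> raisable n (\<lambda>i. - t i)" using fibre_max_not_raisable[OF _ t'] sums' by simp
    moreover have "\<not> raisable n t" using max fibre_max_not_raisable[OF _ t] x y z by simp
    ultimately show "(x, y) \<in> frontier (B_flat n)"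
      using parabola_of_extremal[OF t n] x y iff by simp
  next
    assume "(x, y) \<in> frontier (B_flat n)"
    hence "on_bounding_parabola n (- x) y" using iff n by (simp add: reflect_on_bounding_parabola)
    hence "\<not> raisable n (\<lambda>i. - t i)"
      using not_raisable_of_parabola[OF t'] sums' n by simp
    hence "(\<Sum>i=1..n. twisted_cubic (- t i)) \<in> B_plus n"
      using not_raisable_imp_B_plus[OF t'] n by simp
    hence "(x, y, zp) \<in> B_minus n"
      using sums' by (simp add: reflect_B_minus sum_twisted_cubic)
    thus "zp = zm" using zm B_minus_unique_fibre_point[OF _ xy] n by auto
  qed
qed

text \<open>An end of a fibre cannot be moved vertically both ways within \<open>A3 n\<close>. A
  point strictly between the ends lies over the interior of \<open>B_flat n\<close>, as the ends
  differ, and it avoids two closed sets outside of which \<open>A3 n\<close> fills everything over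
  that interior.\<close>

lemma frontier_A3:
  assumes n: "n \<ge> 3"
  shows "frontier (A3 n) = B_plus n \<union> B_minus n"
proof (intro equalityI subsetI)
  fix p assume p: "p \<in> B_plus n \<union> B_minus n"
  obtain x y z where xyz: "p = (x, y, z)" by (metis prod_cases3)
  have A: "p \<in> A3 n" using p n xyz by (auto simp: B_plus_iff_fibre_max fibre_max_def B_minus_iff)
  have "p \<notin> interior (A3 n)"
  proof
    assume "p \<in> interior (A3 n)"
    then obtain e where "e > 0" "p + e *\<^sub>R (0, 0, 1) \<in> A3 n" "p - e *\<^sub>R (0, 0, 1) \<in> A3 n"
      by (rule interior_shift[where v = "(0, 0, 1)"]) (auto simp: norm_Pair)
    hence "e > 0" "(x, y, z + e) \<in> A3 n" "(x, y, z - e) \<in> A3 n" by (auto simp: xyz)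
    thus False using p n xyz by (force simp: B_plus_iff_fibre_max fibre_max_def B_minus_iff)
  qed
  with A show "p \<in> frontier (A3 n)" using closed_A3 by (auto simp: frontier_def)
next
  have n2: "n \<ge> 2" and n1: "n \<ge> 1" using n by auto
  \<comment> \<open>Points weakly above the graph of the maximum, resp. weakly below that of the minimum; both
    sets are closed, and over the interior of \<open>B_flat n\<close> they cover the complement of \<open>A3 n\<close>.\<close>
  define Up where "Up = (\<Union>b\<in>B_plus n. \<Union>v\<in>{0} \<times> {0} \<times> {0..}. {b + v})"
  define Down where "Down = reflect -` Up"
  have Up_iff: "(x, y, z) \<in> Up \<longleftrightarrow> (\<exists>w\<le>z. (x, y, w) \<in> B_plus n)" for x y z
  proof
    assume "\<exists>w\<le>z. (x, y, w) \<in> B_plus n"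
    then obtain w where "w \<le> z" "(x, y, w) \<in> B_plus n" by blast
    thus "(x, y, z) \<in> Up" unfolding Up_def
      by (intro UN_I[of "(x, y, w)"] UN_I[of "(0, 0, z - w)"]) auto
  next
    assume "(x, y, z) \<in> Up"
    then obtain w e where "(x, y, w) \<in> B_plus n" "0 \<le> e" "z = w + e"
      unfolding Up_def by auto
    thus "\<exists>w\<le>z. (x, y, w) \<in> B_plus n" by (intro exI[of _ w]) simp
  qed
  have Down_iff: "(x, y, z) \<in> Down \<longleftrightarrow> (\<exists>w\<ge>z. (x, y, w) \<in> B_minus n)" for x y z
    unfolding Down_def vimage_eq reflect_simps Up_iff reflect_B_minus by (metis minus_minus neg_le_iff_le)
  have "closed Up" unfolding Up_def
    by (intro compact_closed_sums compact_B_plus closed_Times) auto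
  moreover have "continuous_on UNIV reflect"
    unfolding reflect_def case_prod_beta by (intro continuous_intros)
  ultimately have "closed Down" unfolding Down_def by (simp add: closed_vimage)
  define U where "U = (\<lambda>p. (fst p, fst (snd p))) -` interior (B_flat n) - Up - Down"
  have "open U" unfolding U_def using \<open>closed Up\<close> \<open>closed Down\<close>
    by (intro open_Diff open_vimage open_interior continuous_intros)
  have "U \<subseteq> A3 n"
  proof
    fix q assume q: "q \<in> U"
    obtain x y z where xyz: "q = (x, y, z)" by (metis prod_cases3)
    hence "(x, y) \<in> B_flat n" using q interior_subset by (auto simp: U_def)
    then obtain zp zm where zp: "(x, y, zp) \<in> B_plus n" and zm: "(x, y, zm) \<in> B_minus n"
      using B_plus_unique_fibre_point[OF n2] B_minus_unique_fibre_point[OF n2] by metis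
    have "zm \<le> z" "z \<le> zp"
      using q zp zm unfolding U_def xyz Diff_iff Up_iff Down_iff by (meson linear)+
    thus "q \<in> A3 n"
      using fibre_interval[OF n2, of x y zm zp z] zp zm xyz
      by (simp add: B_plus_iff_fibre_max[OF n2] fibre_max_def B_minus_iff[OF n2])
  qed
  fix p assume p: "p \<in> frontier (A3 n)"
  obtain x y z where xyz: "p = (x, y, z)" by (metis prod_cases3)
  have A: "(x, y, z) \<in> A3 n" using p xyz frontier_subset_closed[OF closed_A3] by blast
  hence xy: "(x, y) \<in> B_flat n" using B_flat_iff_fibre[OF n1] by blast
  then obtain zp zm where zp: "(x, y, zp) \<in> B_plus n" and zm: "(x, y, zm) \<in> B_minus n"
    using B_plus_unique_fibre_point[OF n2] B_minus_unique_fibre_point[OF n2] by metis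
  have le: "zm \<le> z" "z \<le> zp"
    using A zp zm by (auto simp: B_plus_iff_fibre_max[OF n2] fibre_max_def B_minus_iff[OF n2])
  show "p \<in> B_plus n \<union> B_minus n"
  proof (rule ccontr)
    assume "p \<notin> B_plus n \<union> B_minus n"
    hence "z \<noteq> zp" "z \<noteq> zm" using zp zm xyz by auto
    hence lt: "zm < z" "z < zp" using le by auto
    hence "(x, y) \<in> interior (B_flat n)"
      using B_plus_meets_B_minus_iff[OF n zp zm] xy closure_subset by (auto simp: frontier_def)
    moreover have "p \<notin> Up" "p \<notin> Down"
      using lt zp zm B_plus_unique_fibre_point[OF n2 xy] B_minus_unique_fibre_point[OF n2 xy]
      unfolding xyz Up_iff Down_iff by (metis not_le)+
    ultimately have "p \<in> U" by (simp add: U_def xyz)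
    hence "p \<in> interior (A3 n)" using \<open>open U\<close> \<open>U \<subseteq> A3 n\<close> by (meson interiorI)
    thus False using p by (simp add: frontier_def)
  qed
qed

section \<open>Tuples representing boundary points\<close>

definition unique_representation :: "nat \<Rightarrow> real \<times> real \<times> real \<Rightarrow> (nat \<Rightarrow> real) \<Rightarrow> bool" where
  "unique_representation n p t \<longleftrightarrow>
     t \<in> {1..n} \<rightarrow> {-1..1} \<and> p = (\<Sum>i=1..n. twisted_cubic (t i)) \<and>
     card (t ` {1..n} - {-1, 1}) \<le> 2 \<and>
     (\<forall>u. u \<in> {1..n} \<rightarrow> {-1..1} \<and> p = (\<Sum>i=1..n. twisted_cubic (u i)) \<longrightarrow>
        (\<exists>\<sigma>. \<sigma> permutes {1..n} \<and> (\<forall>i\<in>{1..n}. u i = t (\<sigma> i))))"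

text \<open>Every tuple representing a highest point is not raisable, hence a permuted cluster, and
  the cluster is determined by the point. Its entries other than 1 are among \<open>s\<close> and
  \<open>t\<close>.\<close>

lemma unique_representation_B_plus:
  assumes n: "n \<ge> 2" and p: "p \<in> B_plus n"
  shows "\<exists>t. unique_representation n p t"
proof -
  obtain k s t where kst: "k \<in> {1..n-1}" "-1 \<le> s" "s \<le> t" "t \<le> 1"
      and rep: "p = (\<Sum>i=1..n. twisted_cubic (cluster k s t i))"
    using p unfolding B_plus_iff_cluster by blast
  have "cluster k s t ` {1..n} - {-1, 1} \<subseteq> {s, t}" by (auto simp: cluster_def)
  hence "card (cluster k s t ` {1..n} - {-1, 1}) \<le> card {s, t}" by (intro card_mono) auto
  also have "\<dots> \<le> 2" by (simp add: card_insert_if)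
  finally have card: "card (cluster k s t ` {1..n} - {-1, 1}) \<le> 2" .
  have "\<exists>\<sigma>. \<sigma> permutes {1..n} \<and> (\<forall>i\<in>{1..n}. u i = cluster k s t (\<sigma> i))"
    if u: "u \<in> {1..n} \<rightarrow> {-1..1}" and pu: "p = (\<Sum>i=1..n. twisted_cubic (u i))" for u
  proof -
    have "fibre_max n (\<Sum>i=1..n. u i) (\<Sum>i=1..n. u i ^ 2) (\<Sum>i=1..n. u i ^ 3)"
      using p n unfolding pu sum_twisted_cubic by (simp add: B_plus_iff_fibre_max)
    hence "\<not> raisable n u" using u fibre_max_not_raisable by blast
    then obtain k' s' t' \<sigma> where kst': "s' \<le> t'" "t' \<le> 1" and \<sigma>: "\<sigma> permutes {1..n}"
        and u_eq: "\<forall>i\<in>{1..n}. u i = cluster k' s' t' (\<sigma> i)"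
      using not_raisable_imp_cluster[OF u _ n] by metis
    have "(\<Sum>i=1..n. twisted_cubic (u i)) = (\<Sum>i=1..n. twisted_cubic (cluster k' s' t' (\<sigma> i)))"
      by (rule sum.cong) (use u_eq in auto)
    also have "\<dots> = (\<Sum>i=1..n. twisted_cubic (cluster k' s' t' i))"
      using sum.permute[OF \<sigma>, of "\<lambda>i. twisted_cubic (cluster k' s' t' i)"] by (simp add: o_def)
    finally have p': "p = (\<Sum>i=1..n. twisted_cubic (cluster k' s' t' i))" using pu by simp
    have "cluster k s t i = cluster k' s' t' i" if "i \<in> {1..n}" for i
      by (rule cluster_unique'[OF kst(3,4) kst' _ _ that])
        (use rep p' in \<open>auto simp: sum_twisted_cubic\<close>)
    hence "\<forall>i\<in>{1..n}. u i = cluster k s t (\<sigma> i)"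
      using u_eq permutes_in_image[OF \<sigma>] by metis
    with \<sigma> show ?thesis by blast
  qed
  thus ?thesis
    using cluster_in_cube[OF kst(2-4), of k "{1..n}"] rep card
    unfolding unique_representation_def by blast
qed

lemma unique_representation_reflect:
  assumes "unique_representation n (reflect p) t"
  shows "unique_representation n p (\<lambda>i. - t i)"
proof -
  have t: "t \<in> {1..n} \<rightarrow> {-1..1}" and p: "reflect p = (\<Sum>i=1..n. twisted_cubic (t i))"
    and card: "card (t ` {1..n} - {-1, 1}) \<le> 2"
    and uniq: "\<And>u. u \<in> {1..n} \<rightarrow> {-1..1} \<Longrightarrow> reflect p = (\<Sum>i=1..n. twisted_cubic (u i)) \<Longrightarrow>
        \<exists>\<sigma>. \<sigma> permutes {1..n} \<and> (\<forall>i\<in>{1..n}. u i = t (\<sigma> i))"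
    using assms unfolding unique_representation_def by blast+
  have "(\<lambda>i. - t i) \<in> {1..n} \<rightarrow> {-1..1}" using t by (force simp: Pi_iff)
  moreover have "p = (\<Sum>i=1..n. twisted_cubic (- t i))"
    using arg_cong[OF p, of reflect] by (simp add: reflect_sum)
  moreover have "(\<lambda>i. - t i) ` {1..n} - {-1, 1} = uminus ` (t ` {1..n} - {-1, 1})"
    by (force simp: image_iff)
  hence "card ((\<lambda>i. - t i) ` {1..n} - {-1, 1}) \<le> 2"
    using card card_image_le[of "t ` {1..n} - {-1, 1}" uminus] by simp
  moreover have "\<exists>\<sigma>. \<sigma> permutes {1..n} \<and> (\<forall>i\<in>{1..n}. u i = - t (\<sigma> i))"
    if "u \<in> {1..n} \<rightarrow> {-1..1}" "p = (\<Sum>i=1..n. twisted_cubic (u i))" for u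
  proof -
    have "(\<lambda>i. - u i) \<in> {1..n} \<rightarrow> {-1..1}" using that(1) by (force simp: Pi_iff)
    moreover have "reflect p = (\<Sum>i=1..n. twisted_cubic (- u i))"
      unfolding that(2) by (rule reflect_sum)
    ultimately obtain \<sigma> where "\<sigma> permutes {1..n}" "\<forall>i\<in>{1..n}. - u i = t (\<sigma> i)"
      using uniq[of "\<lambda>i. - u i"] by blast
    thus ?thesis by (metis minus_minus)
  qed
  ultimately show ?thesis unfolding unique_representation_def by blast
qed

theorem theorem2p1:
  fixes n :: nat
  assumes "n \<ge> 3"
  shows
    "frontier (A3 n) = B_plus n \<union> B_minus n
   \<and> (proj_xy ` B_plus n = B_flat n \<and> proj_xy ` B_minus n = B_flat n)
   \<and> (\<forall>x y. (x, y) \<in> B_flat n \<longrightarrow>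
        (\<exists>!zp. (x, y, zp) \<in> B_plus n) \<and>
        (\<exists>!zm. (x, y, zm) \<in> B_minus n) \<and>
        (\<forall>zp zm. (x, y, zp) \<in> B_plus n \<longrightarrow> (x, y, zm) \<in> B_minus n \<longrightarrow>
           zp \<ge> zm \<and>
           (zp = zm \<longleftrightarrow> (x, y) \<in> frontier (B_flat n)) \<and>
           (\<forall>z. (x, y, z) \<in> A3 n \<longleftrightarrow> zp \<ge> z \<and> z \<ge> zm)))
   \<and> (\<forall>p\<in>frontier (A3 n).
        \<exists>t. t \<in> {1..n} \<rightarrow> {-1..1} \<and> p = (\<Sum>i=1..n. twisted_cubic (t i)) \<and>
            card (t ` {1..n} - {-1, 1}) \<le> 2 \<and>
            (\<forall>u. u \<in> {1..n} \<rightarrow> {-1..1} \<and> p = (\<Sum>i=1..n. twisted_cubic (u i)) \<longrightarrow>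
               (\<exists>\<sigma>. \<sigma> permutes {1..n} \<and> (\<forall>i\<in>{1..n}. u i = t (\<sigma> i)))))"
proof (intro conjI)
  have n: "n \<ge> 2" using assms by simp
  show "frontier (A3 n) = B_plus n \<union> B_minus n" using frontier_A3[OF assms] .
  show "proj_xy ` B_plus n = B_flat n" "proj_xy ` B_minus n = B_flat n"
    using proj_B_plus[OF n] proj_B_minus[OF n] by auto
  show "\<forall>x y. (x, y) \<in> B_flat n \<longrightarrow>
        (\<exists>!zp. (x, y, zp) \<in> B_plus n) \<and>
        (\<exists>!zm. (x, y, zm) \<in> B_minus n) \<and>
        (\<forall>zp zm. (x, y, zp) \<in> B_plus n \<longrightarrow> (x, y, zm) \<in> B_minus n \<longrightarrow>
           zp \<ge> zm \<and>
           (zp = zm \<longleftrightarrow> (x, y) \<in> frontier (B_flat n)) \<and>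
           (\<forall>z. (x, y, z) \<in> A3 n \<longleftrightarrow> zp \<ge> z \<and> z \<ge> zm))"
  proof (intro allI impI conjI)
    fix x y assume xy: "(x, y) \<in> B_flat n"
    show "\<exists>!zp. (x, y, zp) \<in> B_plus n" "\<exists>!zm. (x, y, zm) \<in> B_minus n"
      using B_plus_unique_fibre_point[OF n xy] B_minus_unique_fibre_point[OF n xy] by auto
    fix zp zm assume zp: "(x, y, zp) \<in> B_plus n" and zm: "(x, y, zm) \<in> B_minus n"
    have top: "(x, y, zp) \<in> A3 n" "\<And>z. (x, y, z) \<in> A3 n \<Longrightarrow> z \<le> zp"
      using zp by (auto simp: B_plus_iff_fibre_max[OF n] fibre_max_def)
    have bot: "(x, y, zm) \<in> A3 n" "\<And>z. (x, y, z) \<in> A3 n \<Longrightarrow> zm \<le> z"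
      using zm by (auto simp: B_minus_iff[OF n])
    show "zp \<ge> zm" using top bot by blast
    show "zp = zm \<longleftrightarrow> (x, y) \<in> frontier (B_flat n)"
      using B_plus_meets_B_minus_iff[OF assms zp zm] .
    show "(x, y, z) \<in> A3 n \<longleftrightarrow> zp \<ge> z \<and> z \<ge> zm" for z
      using top bot fibre_interval[OF n bot(1) top(1)] by blast
  qed
  \<comment> \<open>A point of \<open>B_minus n\<close> gets its tuple by negating one for its
    reflection in \<open>B_plus n\<close>.\<close>
  have "\<exists>t. unique_representation n p t" if "p \<in> frontier (A3 n)" for p
    using that unique_representation_B_plus[OF n] unique_representation_reflect
    unfolding frontier_A3[OF assms] Un_iff reflect_B_minus by blast
  thus "\<forall>p\<in>frontier (A3 n).
        \<exists>t. t \<in> {1..n} \<rightarrow> {-1..1} \<and> p = (\<Sum>i=1..n. twisted_cubic (t i)) \<and>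
            card (t ` {1..n} - {-1, 1}) \<le> 2 \<and>
            (\<forall>u. u \<in> {1..n} \<rightarrow> {-1..1} \<and> p = (\<Sum>i=1..n. twisted_cubic (u i)) \<longrightarrow>
               (\<exists>\<sigma>. \<sigma> permutes {1..n} \<and> (\<forall>i\<in>{1..n}. u i = t (\<sigma> i))))"
    unfolding unique_representation_def by blast
qed

end
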